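(* Let $G$ be a non-abelian group of order $\leq 12$, let $H$ be a subgroup of $G$ with $H \neq Z(H,G)$, and let $g = 1$. Then $\Delta_{H,G}^g$ is a tree if and only if ($G \cong D_6$ or $G \cong D_{10}$) and $|H| = 2$.
   Context: For a subgroup $H$ of a finite non-abelian group $G$, write $[x,y] = x^{-1}y^{-1}xy$ and $Z(H,G) = \{x \in H : xy = yx \text{ for all } y \in G\}$. For $g \in G$, $\Delta_{H,G}^g$ is the simple graph with vertex set $G \setminus Z(H,G)$ in which two distinct vertices $x,y$ are adjacent if and only if ($x \in H$ or $y \in H$) and $[x,y] \neq g$ and $[x,y] \neq g^{-1}$. $D_{2n}$ denotes the dihedral group of order $2n$. *)

theory Defs
  imports
    "HOL-Algebra.Algebra"
    "Graph_Theory.Graph_Theory"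
begin

definition commutator :: "('a, 'b) monoid_scheme \<Rightarrow> 'a \<Rightarrow> 'a \<Rightarrow> 'a" where
  "commutator G x y = inv\<^bsub>G\<^esub> x \<otimes>\<^bsub>G\<^esub> inv\<^bsub>G\<^esub> y \<otimes>\<^bsub>G\<^esub> x \<otimes>\<^bsub>G\<^esub> y"

definition relative_centre :: "('a, 'b) monoid_scheme \<Rightarrow> 'a set \<Rightarrow> 'a set" where
  "relative_centre G H = {x \<in> H. \<forall>y \<in> carrier G. x \<otimes>\<^bsub>G\<^esub> y = y \<otimes>\<^bsub>G\<^esub> x}"

text \<open>Simple graphs are represented as loop-free symmetric digraphs: an edge between \<open>x\<close> and \<open>y\<close>
  is the pair of arcs \<open>(x, y)\<close>, \<open>(y, x)\<close>.\<close>

definition noncomm_graph ::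
    "('a, 'b) monoid_scheme \<Rightarrow> 'a set \<Rightarrow> 'a \<Rightarrow> 'a pair_pre_digraph" where
  "noncomm_graph G H g =
    \<lparr> pverts = carrier G - relative_centre G H,
      parcs = {(x, y). x \<in> carrier G - relative_centre G H \<and> y \<in> carrier G - relative_centre G H
                \<and> x \<noteq> y \<and> (x \<in> H \<or> y \<in> H)
                \<and> commutator G x y \<noteq> g \<and> commutator G x y \<noteq> inv\<^bsub>G\<^esub> g} \<rparr>"

text \<open>The constant \<open>tree\<close> of the digraph library does not apply to symmetric digraphs, since it
  counts the closed walk \<open>x, y, x\<close> along a single edge as a cycle. A cycle of a simple graph has
  at least three edges.\<close>

definition undirected_tree :: "'a pair_pre_digraph \<Rightarrow> bool" where
  "undirected_tree D \<longleftrightarrow> Digraph_Component.connected (with_proj D) \<and>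
     \<not> (\<exists>p. pre_digraph.cycle (with_proj D) p \<and> 3 \<le> length p)"

text \<open>The dihedral group of order \<open>2 * n\<close>: \<open>(a, False)\<close> is the rotation \<open>r^a\<close> and \<open>(a, True)\<close> the
  reflection \<open>r^a s\<close>, where \<open>s r s = r^(-1)\<close>.\<close>

definition dihedral :: "nat \<Rightarrow> (int \<times> bool) monoid" where
  "dihedral n =
    \<lparr> carrier = {0..<int n} \<times> UNIV,
      monoid.mult = (\<lambda>(a, s) (b, t). ((if s then a - b else a + b) mod int n, s \<noteq> t)),
      monoid.one = (0, False) \<rparr>"

lemma order_dihedral: "order (dihedral n) = 2 * n"
  by (simp add: order_def dihedral_def card_cartesian_product)

lemma group_dihedral:
  assumes "n > 0"
  shows "group (dihedral n)"
proof (rule groupI)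
  fix x y z :: "int \<times> bool"
  obtain a s b t c u where [simp]: "x = (a, s)" "y = (b, t)" "z = (c, u)"
    by (cases x, cases y, cases z)
  show "x \<otimes>\<^bsub>dihedral n\<^esub> y \<otimes>\<^bsub>dihedral n\<^esub> z = x \<otimes>\<^bsub>dihedral n\<^esub> (y \<otimes>\<^bsub>dihedral n\<^esub> z)"
    by (cases s; cases t; simp add: dihedral_def mod_simps; simp add: algebra_simps)
next
  fix x
  assume x: "x \<in> carrier (dihedral n)"
  obtain a s where [simp]: "x = (a, s)" by (cases x)
  show "\<exists>y \<in> carrier (dihedral n). y \<otimes>\<^bsub>dihedral n\<^esub> x = \<one>\<^bsub>dihedral n\<^esub>"
    using x assms
    by (intro bexI[of _ "(if s then a else (- a) mod int n, s)"])
       (simp_all add: dihedral_def mod_simps)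
qed (use assms in \<open>auto simp: dihedral_def\<close>)

lemma (in group) commutator_swap:
  assumes "x \<in> carrier G" "y \<in> carrier G"
  shows "commutator G y x = inv (commutator G x y)"
  using assms by (simp add: commutator_def inv_mult_group m_assoc)

lemma (in group) pair_graph_noncomm_graph:
  assumes "finite (carrier G)" "g \<in> carrier G"
  shows "pair_graph (noncomm_graph G H g)"
proof
  show "finite (parcs (noncomm_graph G H g))"
    by (rule finite_subset[of _ "carrier G \<times> carrier G"])
       (use assms in \<open>auto simp: noncomm_graph_def\<close>)
  have closed: "commutator G x y \<in> carrier G" if "x \<in> carrier G" "y \<in> carrier G" for x y
    using that by (simp add: commutator_def)
  have "(y, x) \<in> parcs (noncomm_graph G H g)" if xy: "(x, y) \<in> parcs (noncomm_graph G H g)" for x y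
  proof -
    have x: "x \<in> carrier G" and y: "y \<in> carrier G"
      and ne: "commutator G x y \<noteq> g" "commutator G x y \<noteq> inv g"
      using xy by (simp_all add: noncomm_graph_def)
    have "commutator G y x \<noteq> inv g"
      using ne(1) inv_inv[OF closed[OF x y]] inv_inv[OF assms(2)] commutator_swap[OF x y] by metis
    moreover have "commutator G y x \<noteq> g"
      using ne(2) inv_inv[OF closed[OF x y]] commutator_swap[OF x y] by metis
    ultimately show ?thesis
      using xy by (simp add: noncomm_graph_def) blast
  qed
  then have "sym (parcs (noncomm_graph G H g))"
    by (rule symI)
  then show "symmetric (with_proj (noncomm_graph G H g))"
    by (simp add: symmetric_def arcs_ends_def arc_to_ends_def with_proj_def)
qed (use assms in \<open>auto simp: noncomm_graph_def\<close>)

end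

theory Submission
  imports Defs
begin

text \<open>For \<open>g = 1\<close> two vertices are adjacent exactly when they do not commute and one of them lies
  in \<open>H\<close>. Two non-central elements \<open>a, b\<close> of \<open>H\<close> with \<open>a \<noteq> b\<close> whose centralizers share an element
  other than \<open>1\<close> lie on a 4-cycle: each centralizer fills at most half of \<open>G\<close>, so the overlap
  leaves at least two elements that commute with neither \<open>a\<close> nor \<open>b\<close>
  (\<open>tree_imp_no_shared_commuting\<close>). Connectedness puts the centre of \<open>G\<close> inside \<open>H\<close>, since a
  central element outside \<open>H\<close> would be an isolated vertex. Applying the 4-cycle argument to
  suitable pairs then shows that in a tree \<open>H = {1, x}\<close> for an involution \<open>x\<close> with centralizer
  \<open>{1, x}\<close>. Conversely, for such \<open>H\<close> the graph is a star with centre \<open>x\<close>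
  (\<open>undirected_tree_noncomm_graph_iff\<close>).

  A finite group with a self-centralizing involution \<open>x\<close> is a generalized dihedral group: the
  conjugates of \<open>x\<close> are half of \<open>G\<close>, and the other half is a subgroup of odd order that \<open>x\<close>
  inverts. A non-abelian group of order at most 12 leaves only the odd orders 3 and 5 for this
  subgroup. Both are prime, so the subgroup is cyclic and \<open>G\<close> is dihedral
  (\<open>prime_imp_dihedral\<close>). In the other direction, each involution of a dihedral group of order
  \<open>2 n\<close> with \<open>n\<close> odd is self-centralizing
  (\<open>iso_dihedral_involution_self_centralizing\<close>).\<close>

section \<open>Trees among symmetric pair digraphs\<close>

lemma connected_imp_has_neighbour:
  assumes conn: "Digraph_Component.connected (with_proj D)"
    and sym: "sym (parcs D)"
    and u: "u \<in> pverts D" and v: "v \<in> pverts D" and ne: "u \<noteq> v"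
  obtains w where "(u, w) \<in> parcs D"
proof -
  have "(u, v) \<in> rtrancl_on (pverts D) (parcs (mk_symmetric (with_proj D)))"
    using conn u v by (simp add: connected_def strongly_connected_def reachable_def)
  then have "\<exists>w. (u, w) \<in> parcs (mk_symmetric (with_proj D))"
    using ne by (auto elim: converse_rtrancl_on_cases)
  then show thesis
    using that symD[OF sym] by (fastforce simp: parcs_mk_symmetric)
qed

lemma star_connected:
  assumes c: "c \<in> pverts D"
    and spokes: "\<And>v. v \<in> pverts D \<Longrightarrow> v \<noteq> c \<Longrightarrow> (c, v) \<in> parcs D"
  shows "Digraph_Component.connected (with_proj D)"
proof -
  let ?E = "parcs (mk_symmetric (with_proj D))"
  have edges: "(c, v) \<in> ?E \<and> (v, c) \<in> ?E" if "v \<in> pverts D" "v \<noteq> c" for v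
    using spokes[OF that] by (auto simp: parcs_mk_symmetric intro: bexI[of _ "(c, v)"])
  have "(c, v) \<in> rtrancl_on (pverts D) ?E \<and> (v, c) \<in> rtrancl_on (pverts D) ?E"
    if v: "v \<in> pverts D" for v
  proof (cases "v = c")
    case True
    then show ?thesis using c by simp
  next
    case False
    then show ?thesis
      using edges[OF v False] c v by (meson rtrancl_on.intros)
  qed
  then have "(u, v) \<in> rtrancl_on (pverts D) ?E" if "u \<in> pverts D" "v \<in> pverts D" for u v
    using that rtrancl_on_trans by metis
  then show ?thesis
    using c by (auto simp: connected_def strongly_connected_def reachable_def)
qed

text \<open>Every second vertex of a walk is the centre \<open>c\<close>. A closed walk therefore has an even number
  of edges, and with more than two of them it enters \<open>c\<close> more than once.\<close>

lemma star_no_cycle: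
  assumes star: "\<And>a b. (a, b) \<in> parcs D \<Longrightarrow> a \<noteq> b \<and> (a = c \<or> b = c)"
    and cyc: "pre_digraph.cycle (with_proj D) p"
  shows "length p < 3"
proof (rule ccontr)
  assume "\<not> length p < 3"
  then obtain e1 e2 e3 q where p: "p = e1 # e2 # e3 # q"
    by (auto simp: not_less numeral_3_eq_3 Suc_le_length_iff)
  obtain u where walk: "pre_digraph.awalk (with_proj D) u p u"
    and dist: "distinct (tl (pre_digraph.awalk_verts (with_proj D) u p))"
    using cyc by (auto simp: pre_digraph.cycle_def)
  obtain v1 v2 v3 where e: "e1 = (u, v1)" "e2 = (v1, v2)" "e3 = (v2, v3)"
    and cas: "pre_digraph.cas (with_proj D) v3 q u" and arcs: "set p \<subseteq> parcs D"
    using walk unfolding p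
    by (cases e1, cases e2, cases e3) (auto simp: pre_digraph.awalk_def pre_digraph.cas.simps)
  have s: "u \<noteq> v1 \<and> (u = c \<or> v1 = c)" "v1 \<noteq> v2 \<and> (v1 = c \<or> v2 = c)" "v2 \<noteq> v3 \<and> (v2 = c \<or> v3 = c)"
    using star arcs by (simp_all add: p e)
  show False
  proof (cases q)
    case Nil
    then have "v3 = u" using cas by (simp add: pre_digraph.cas.simps)
    then show False using s by blast
  next
    case (Cons e4 q')
    obtain v4 where e4: "e4 = (v3, v4)" using cas Cons
      by (cases e4) (auto simp: pre_digraph.cas.simps)
    have "v3 \<noteq> v4 \<and> (v3 = c \<or> v4 = c)" using star arcs by (simp add: p Cons e4)
    moreover have "v1 \<noteq> v3 \<and> v2 \<noteq> v4"
      using dist cas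
      by (cases q') (auto simp: p Cons e e4 pre_digraph.awalk_verts.simps pre_digraph.cas.simps)
    ultimately show False using s by blast
  qed
qed

lemma tree_no_four_cycle:
  assumes tree: "undirected_tree D" and verts: "a \<in> pverts D"
    and arcs: "(a, c) \<in> parcs D" "(c, b) \<in> parcs D" "(b, d) \<in> parcs D" "(d, a) \<in> parcs D"
  shows "a = b \<or> c = d \<or> a = c \<or> c = b \<or> b = d \<or> d = a"
proof (rule ccontr)
  assume ne: "\<not> ?thesis"
  let ?p = "[(a, c), (c, b), (b, d), (d, a)]"
  have "pre_digraph.awalk (with_proj D) a ?p a"
    using verts arcs by (simp add: pre_digraph.awalk_def pre_digraph.cas.simps)
  moreover have "distinct (tl (pre_digraph.awalk_verts (with_proj D) a ?p))"
    using ne by (auto simp: pre_digraph.awalk_verts.simps)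
  ultimately have "pre_digraph.cycle (with_proj D) ?p"
    by (auto simp: pre_digraph.cycle_def)
  moreover have "3 \<le> length ?p" by simp
  ultimately show False using tree unfolding undirected_tree_def by blast
qed

section \<open>Centralizers\<close>

definition centralizer :: "('a, 'b) monoid_scheme \<Rightarrow> 'a \<Rightarrow> 'a set" where
  "centralizer G x = {y \<in> carrier G. x \<otimes>\<^bsub>G\<^esub> y = y \<otimes>\<^bsub>G\<^esub> x}"

context group
begin

lemma subgroup_centralizer:
  assumes "x \<in> carrier G"
  shows "subgroup (centralizer G x) G"
proof (rule subgroupI)
  show "a \<otimes> b \<in> centralizer G x" if "a \<in> centralizer G x" "b \<in> centralizer G x" for a b
    using that assms by (simp add: centralizer_def) (metis m_assoc)
  show "inv a \<in> centralizer G x" if "a \<in> centralizer G x" for a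
    using that assms
    by (simp add: centralizer_def) (metis inv_closed inv_solve_left inv_solve_right m_assoc m_closed)
qed (use assms in \<open>auto simp: centralizer_def\<close>)

lemma commutator_eq_one_iff:
  assumes "x \<in> carrier G" "y \<in> carrier G"
  shows "commutator G x y = \<one> \<longleftrightarrow> x \<otimes> y = y \<otimes> x"
proof -
  have "commutator G x y = inv (y \<otimes> x) \<otimes> (x \<otimes> y)"
    using assms by (simp add: commutator_def inv_mult_group m_assoc)
  then show ?thesis
    using assms inv_solve_left'[of "\<one>" "y \<otimes> x" "x \<otimes> y"] by auto
qed

lemma noncomm_graph_one_simps:
  assumes "H \<subseteq> carrier G"
  shows "pverts (noncomm_graph G H \<one>) = carrier G - {x \<in> H. centralizer G x = carrier G}"
    and "(x, y) \<in> parcs (noncomm_graph G H \<one>) \<longleftrightarrow>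
      x \<in> carrier G \<and> y \<in> carrier G \<and> (x \<in> H \<or> y \<in> H) \<and> y \<notin> centralizer G x"
  using assms
  by (auto simp: noncomm_graph_def relative_centre_def centralizer_def commutator_eq_one_iff
      intro: sym)

lemma sym_parcs_noncomm_graph_one:
  assumes "H \<subseteq> carrier G"
  shows "sym (parcs (noncomm_graph G H \<one>))"
  by (rule symI) (auto simp: noncomm_graph_one_simps[OF assms] centralizer_def)

lemma proper_subgroup_card_le_half:
  assumes fin: "finite (carrier G)" and C: "subgroup C G" "C \<noteq> carrier G"
  shows "2 * card C \<le> order G"
proof -
  have lag: "card (rcosets C) * card C = order G"
    using lagrange_finite[OF fin C(1)] by (simp add: order_def)
  have "card C < order G"
    unfolding order_def using fin C subgroup.subset by (metis psubsetI psubset_card_mono)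
  then have "card (rcosets C) \<noteq> 0 \<and> card (rcosets C) \<noteq> 1"
    using lag by (intro conjI notI) simp_all
  then have "2 \<le> card (rcosets C)" by linarith
  then show ?thesis
    using lag mult_le_mono1 by metis
qed

text \<open>Each centralizer is a proper subgroup, hence at most half of the group, so the two leave at
  least as many elements uncovered as they share. They share \<open>\<one>\<close> and \<open>w\<close>.\<close>

lemma two_common_non_commuting:
  assumes fin: "finite (carrier G)" and a: "a \<in> carrier G" "centralizer G a \<noteq> carrier G"
    and b: "b \<in> carrier G" "centralizer G b \<noteq> carrier G"
    and w: "w \<in> centralizer G a" "w \<in> centralizer G b" "w \<noteq> \<one>"
  obtains c d where "c \<noteq> d" "c \<in> carrier G" "d \<in> carrier G"
    "c \<notin> centralizer G a" "c \<notin> centralizer G b" "d \<notin> centralizer G a" "d \<notin> centralizer G b"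
proof -
  let ?A = "centralizer G a" and ?B = "centralizer G b"
  have sub: "?A \<subseteq> carrier G" "?B \<subseteq> carrier G"
    by (auto simp: centralizer_def)
  have finAB: "finite ?A" "finite ?B"
    using fin sub finite_subset by blast+
  have "card {\<one>, w} \<le> card (?A \<inter> ?B)"
    using finAB w subgroup.one_closed[OF subgroup_centralizer] a b by (intro card_mono) auto
  then have "2 \<le> card (?A \<inter> ?B)" using w by simp
  moreover have "2 * card ?A \<le> order G" "2 * card ?B \<le> order G"
    using proper_subgroup_card_le_half[OF fin subgroup_centralizer] a b by blast+
  moreover have "card ?A + card ?B = card (?A \<union> ?B) + card (?A \<inter> ?B)"
    by (rule card_Un_Int[OF finAB])
  moreover have "card (carrier G - (?A \<union> ?B)) = order G - card (?A \<union> ?B)"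
    unfolding order_def using sub finAB by (intro card_Diff_subset) auto
  ultimately have "2 \<le> card (carrier G - (?A \<union> ?B))" by linarith
  then obtain T where "T \<subseteq> carrier G - (?A \<union> ?B)" "card T = 2"
    using obtain_subset_with_card_n by metis
  then show thesis using that by (auto simp: card_2_iff)
qed

text \<open>Otherwise two elements \<open>c, d\<close> commuting with neither \<open>a\<close> nor \<open>b\<close> close the 4-cycle
  \<open>a, c, b, d\<close>.\<close>

lemma tree_imp_no_shared_commuting:
  assumes fin: "finite (carrier G)" and H: "H \<subseteq> carrier G"
    and tree: "undirected_tree (noncomm_graph G H \<one>)"
    and a: "a \<in> H" "centralizer G a \<noteq> carrier G" and b: "b \<in> H" "centralizer G b \<noteq> carrier G"
    and ne: "a \<noteq> b"
    and w: "w \<in> centralizer G a" "w \<in> centralizer G b"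
  shows "w = \<one>"
proof (rule ccontr)
  assume "w \<noteq> \<one>"
  then obtain c d where cd: "c \<noteq> d" "c \<in> carrier G" "d \<in> carrier G"
    "c \<notin> centralizer G a" "c \<notin> centralizer G b" "d \<notin> centralizer G a" "d \<notin> centralizer G b"
    using two_common_non_commuting[OF fin _ a(2) _ b(2) w] a(1) b(1) H by blast
  have "a = b \<or> c = d \<or> a = c \<or> c = b \<or> b = d \<or> d = a"
    using tree by (rule tree_no_four_cycle)
      (use cd a b H in \<open>auto simp: noncomm_graph_one_simps[OF H] centralizer_def\<close>)
  then show False
    using cd ne a b H by (auto simp: centralizer_def)
qed

text \<open>The ban on shared commuting elements is applied three times. For central \<open>z\<close> the pair
  \<open>a, a z\<close> shares \<open>z\<close>, so the centre is trivial. The pair \<open>h, inv h\<close> shares \<open>h\<close>, so every element of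
  \<open>H\<close> squares to \<open>\<one>\<close> and \<open>H\<close> is abelian. Then any two distinct elements of \<open>H\<close> other than \<open>\<one>\<close> share
  one of themselves, so \<open>a\<close> is the only one. Finally, an element outside \<open>H\<close> commuting with \<open>a\<close>
  would be an isolated vertex.\<close>

lemma tree_imp_self_centralizing:
  assumes fin: "finite (carrier G)" and sub: "subgroup H G"
    and tree: "undirected_tree (noncomm_graph G H \<one>)"
    and a: "a \<in> H" "centralizer G a \<noteq> carrier G"
  shows "H = {\<one>, a} \<and> centralizer G a = {\<one>, a}"
proof -
  interpret H: subgroup H G by (rule sub)
  note gs = noncomm_graph_one_simps[OF H.subset]
  note shared = tree_imp_no_shared_commuting[OF fin H.subset tree]
  have ac: "a \<in> carrier G" using a by simp
  have one_central: "centralizer G \<one> = carrier G" by (auto simp: centralizer_def)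
  have a1: "a \<noteq> \<one>" using a one_central by auto
  \<comment> \<open>The vertex \<open>a\<close> is a second vertex, so no vertex outside \<open>H\<close> may be isolated.\<close>
  have nbr: "\<exists>w. (u, w) \<in> parcs (noncomm_graph G H \<one>)" if "u \<in> carrier G" "u \<notin> H" for u
  proof -
    have "u \<in> pverts (noncomm_graph G H \<one>)" "a \<in> pverts (noncomm_graph G H \<one>)" "u \<noteq> a"
      using that a by (auto simp: gs)
    moreover have "Digraph_Component.connected (with_proj (noncomm_graph G H \<one>))"
      using tree by (simp add: undirected_tree_def)
    ultimately show ?thesis
      using connected_imp_has_neighbour sym_parcs_noncomm_graph_one[OF H.subset] by metis
  qed
  have central: "z = \<one>" if z: "z \<in> carrier G" "centralizer G z = carrier G" for z
  proof (rule ccontr)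
    assume z1: "z \<noteq> \<one>"
    have comm: "z \<otimes> y = y \<otimes> z" if "y \<in> carrier G" for y
      using z that by (auto simp: centralizer_def)
    have zH: "z \<in> H"
      using nbr[OF z(1)] z by (auto simp: gs)
    have "a \<otimes> z \<otimes> y = y \<otimes> (a \<otimes> z) \<longleftrightarrow> a \<otimes> y = y \<otimes> a" if y: "y \<in> carrier G" for y
    proof -
      have "a \<otimes> z \<otimes> y = a \<otimes> y \<otimes> z" "y \<otimes> (a \<otimes> z) = y \<otimes> a \<otimes> z"
        using comm[OF y] ac z(1) y by (simp_all add: m_assoc)
      then show ?thesis using ac z(1) y by simp
    qed
    then have cz: "centralizer G (a \<otimes> z) = centralizer G a"
      by (auto simp: centralizer_def)
    have "a \<otimes> z \<noteq> a" using ac z(1) z1 by simp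
    moreover have "z \<in> centralizer G a"
      using comm ac z(1) by (simp add: centralizer_def)
    ultimately show False
      using shared[of a "a \<otimes> z" z] a zH cz z1 by auto
  qed
  have noncentral: "centralizer G h \<noteq> carrier G" if "h \<in> H" "h \<noteq> \<one>" for h
    using central that by auto
  have involution: "inv h = h" if h: "h \<in> H" for h
  proof (cases "h = \<one>")
    case False
    have hc: "h \<in> carrier G" using h by simp
    have "h \<in> centralizer G h" "h \<in> centralizer G (inv h)"
      using hc by (simp_all add: centralizer_def)
    moreover have "inv h \<in> H" "inv h \<noteq> \<one>"
      using h hc False by auto
    ultimately show ?thesis
      using shared[OF h _ \<open>inv h \<in> H\<close> _ _, of h] noncentral h False by metis
  qed simp
  have H2: "H = {\<one>, a}"
  proof (rule ccontr)
    assume "H \<noteq> {\<one>, a}"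
    then obtain h where h: "h \<in> H" "h \<noteq> \<one>" "h \<noteq> a" using a by auto
    \<comment> \<open>\<open>h a = inv (h a) = inv a inv h = a h\<close>\<close>
    have "h \<otimes> a = a \<otimes> h"
      using involution[of "h \<otimes> a"] involution h(1) a(1) inv_mult_group[of h a] by simp
    then have "a \<in> centralizer G h" "a \<in> centralizer G a"
      using ac by (simp_all add: centralizer_def)
    then show False
      using shared[of h a a] noncentral h a a1 by auto
  qed
  have "y \<in> {\<one>, a}" if y: "y \<in> centralizer G a" for y
  proof (rule ccontr)
    assume "y \<notin> {\<one>, a}"
    then have yH: "y \<notin> H" using H2 by simp
    have yc: "y \<in> carrier G" using y by (simp add: centralizer_def)
    obtain w where "(y, w) \<in> parcs (noncomm_graph G H \<one>)" using nbr[OF yc yH] by blast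
    then have "w \<in> H" "w \<notin> centralizer G y" using yH by (auto simp: gs)
    then show False
      using y H2 ac by (auto simp: centralizer_def)
  qed
  then have "centralizer G a = {\<one>, a}"
    using ac by (auto simp: centralizer_def)
  with H2 show ?thesis by blast
qed

lemma self_centralizing_imp_tree:
  assumes x: "x \<in> carrier G" "centralizer G x \<noteq> carrier G"
    and C: "centralizer G x = {\<one>, x}" and H: "H = {\<one>, x}"
  shows "undirected_tree (noncomm_graph G H \<one>)"
proof -
  have sub: "H \<subseteq> carrier G" using x H by auto
  have one_central: "centralizer G \<one> = carrier G" by (auto simp: centralizer_def)
  have "Digraph_Component.connected (with_proj (noncomm_graph G H \<one>))"
    by (rule star_connected[of x])
       (use x C H one_central in \<open>auto simp: noncomm_graph_one_simps[OF sub, unfolded H]\<close>)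
  moreover have "length p < 3" if "pre_digraph.cycle (with_proj (noncomm_graph G H \<one>)) p" for p
  proof (rule star_no_cycle[OF _ that])
    show "u \<noteq> v \<and> (u = x \<or> v = x)" if "(u, v) \<in> parcs (noncomm_graph G H \<one>)" for u v
      using that unfolding noncomm_graph_one_simps[OF sub] by (auto simp: H centralizer_def)
  qed
  ultimately show ?thesis
    unfolding undirected_tree_def by (meson leD)
qed

text \<open>The right-hand side does not say that \<open>x\<close> is non-central: this follows from
  \<open>H \<noteq> relative_centre G H\<close>, which provides a non-central element of \<open>H\<close>, necessarily \<open>x\<close>.\<close>

theorem undirected_tree_noncomm_graph_iff:
  assumes fin: "finite (carrier G)" and sub: "subgroup H G" and nc: "H \<noteq> relative_centre G H"
  shows "undirected_tree (noncomm_graph G H \<one>) \<longleftrightarrow>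
    (\<exists>x. H = {\<one>, x} \<and> centralizer G x = {\<one>, x})"
proof -
  obtain a where a: "a \<in> H" "centralizer G a \<noteq> carrier G"
    using nc by (auto simp: relative_centre_def centralizer_def)
  have ac: "a \<in> carrier G" using a(1) sub subgroup.mem_carrier by metis
  have "centralizer G \<one> = carrier G" by (auto simp: centralizer_def)
  then have "a \<noteq> \<one>" using a by auto
  then show ?thesis
    using tree_imp_self_centralizing[OF fin sub _ a] self_centralizing_imp_tree[OF ac a(2)] a(1)
    by auto
qed

end

section \<open>Groups with a self-centralizing involution\<close>

locale self_centralizing_involution = group G for G (structure) +
  fixes x
  assumes finite_carrier: "finite (carrier G)"
    and x_closed [simp]: "x \<in> carrier G"
    and x_ne_one: "x \<noteq> \<one>"
    and centralizer_x: "centralizer G x = {\<one>, x}"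
begin

lemma x_square [simp]: "x \<otimes> x = \<one>"
proof -
  have "x \<otimes> x \<in> centralizer G x" by (simp add: centralizer_def m_assoc)
  then show ?thesis using centralizer_x x_ne_one by auto
qed

lemma inv_x [simp]: "inv x = x"
  by (rule inv_equality) simp_all

lemma commutes_with_x:
  "y \<in> carrier G \<Longrightarrow> x \<otimes> y = y \<otimes> x \<Longrightarrow> y \<in> {\<one>, x}"
  using centralizer_x by (auto simp: centralizer_def)

text \<open>The names anticipate the structure: the conjugates of \<open>x\<close> are the reflections of a
  generalized dihedral group, and the remaining elements its rotations.\<close>

definition reflections :: "'a set" where
  "reflections = (\<lambda>h. h \<otimes> x \<otimes> inv h) ` carrier G"

definition rotations :: "'a set" where
  "rotations = carrier G - reflections"

lemma reflections_closed: "k \<in> reflections \<Longrightarrow> k \<in> carrier G"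
  by (auto simp: reflections_def)

lemma x_reflection: "x \<in> reflections"
  unfolding reflections_def by (rule image_eqI[of _ _ \<one>]) simp_all

lemma conjugate_self_centralizing:
  assumes h: "h \<in> carrier G"
  shows "self_centralizing_involution G (h \<otimes> x \<otimes> inv h)"
proof unfold_locales
  let ?k = "h \<otimes> x \<otimes> inv h"
  show "?k \<in> carrier G" using h by simp
  show "?k \<noteq> \<one>"
  proof
    assume "?k = \<one>"
    then have "h \<otimes> x = h \<otimes> \<one>" using h inv_solve_right'[of \<one> "h \<otimes> x" h] by simp
    then show False using h x_ne_one l_cancel[of h x \<one>] by simp
  qed
  have "y \<in> {\<one>, ?k}" if y: "y \<in> carrier G" "?k \<otimes> y = y \<otimes> ?k" for y
  proof -
    let ?z = "inv h \<otimes> y \<otimes> h"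
    have y_eq: "h \<otimes> ?z \<otimes> inv h = y" using h y by (simp add: m_assoc) (simp flip: m_assoc)
    have "x \<otimes> ?z = inv h \<otimes> (?k \<otimes> y) \<otimes> h"
      using h y(1) by (simp add: m_assoc) (simp flip: m_assoc)
    also have "\<dots> = ?z \<otimes> x"
      unfolding y(2) using h y(1) by (simp add: m_assoc)
    finally have "?z \<in> {\<one>, x}" using h y(1) by (intro commutes_with_x) simp_all
    then show ?thesis using y_eq h by auto
  qed
  then show "centralizer G ?k = {\<one>, ?k}"
    using h by (auto simp: centralizer_def)
qed (rule finite_carrier)

lemma reflection_self_centralizing:
  "k \<in> reflections \<Longrightarrow> self_centralizing_involution G k"
  using conjugate_self_centralizing by (auto simp: reflections_def)

text \<open>With \<open>reflection_self_centralizing\<close> this makes every fact about \<open>x\<close> and the reflections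
  available for each reflection \<open>k\<close> in place of \<open>x\<close>.\<close>

lemma reflections_conjugate:
  assumes k: "k \<in> reflections"
  shows "self_centralizing_involution.reflections G k = reflections"
proof -
  interpret K: self_centralizing_involution G k
    by (rule reflection_self_centralizing[OF k])
  obtain h where h: "h \<in> carrier G" "k = h \<otimes> x \<otimes> inv h"
    using k by (auto simp: reflections_def)
  have up: "g \<otimes> k \<otimes> inv g = (g \<otimes> h) \<otimes> x \<otimes> inv (g \<otimes> h)" if "g \<in> carrier G" for g
    using h that by (simp add: m_assoc inv_mult_group)
  have down: "g \<otimes> x \<otimes> inv g = (g \<otimes> inv h) \<otimes> k \<otimes> inv (g \<otimes> inv h)" if "g \<in> carrier G" for g
    using h that by (simp add: m_assoc inv_mult_group) (simp flip: m_assoc)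
  show ?thesis
    unfolding K.reflections_def reflections_def
  proof (intro equalityI subsetI)
    fix y assume "y \<in> (\<lambda>h. h \<otimes> k \<otimes> inv h) ` carrier G"
    then obtain g where "g \<in> carrier G" "y = g \<otimes> k \<otimes> inv g" by blast
    then show "y \<in> (\<lambda>h. h \<otimes> x \<otimes> inv h) ` carrier G"
      using up h(1) by (intro image_eqI[of _ _ "g \<otimes> h"]) simp_all
  next
    fix y assume "y \<in> (\<lambda>h. h \<otimes> x \<otimes> inv h) ` carrier G"
    then obtain g where "g \<in> carrier G" "y = g \<otimes> x \<otimes> inv g" by blast
    then show "y \<in> (\<lambda>h. h \<otimes> k \<otimes> inv h) ` carrier G"
      using down h(1) by (intro image_eqI[of _ _ "g \<otimes> inv h"]) simp_all
  qed
qed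

text \<open>Two conjugators giving the same conjugate differ by an element of \<open>centralizer G x\<close>, so the
  class of \<open>x\<close> contains at least half of the group.\<close>

lemma order_le_twice_reflections: "order G \<le> 2 * card reflections"
proof -
  let ?c = "\<lambda>h. h \<otimes> x \<otimes> inv h"
  have fibre: "card {g \<in> carrier G. ?c g = k} \<le> 2" if k: "k \<in> reflections" for k
  proof -
    obtain h where h: "h \<in> carrier G" "k = ?c h" using k by (auto simp: reflections_def)
    have "g \<in> {h, h \<otimes> x}" if g: "g \<in> carrier G" "?c g = k" for g
    proof -
      let ?z = "inv h \<otimes> g"
      have "x \<otimes> ?z = inv h \<otimes> ?c h \<otimes> g" using h g(1) by (simp add: m_assoc) (simp flip: m_assoc)
      also have "\<dots> = inv h \<otimes> ?c g \<otimes> g" using g h by simp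
      also have "\<dots> = ?z \<otimes> x" using h g(1) by (simp add: m_assoc)
      finally have "?z \<in> {\<one>, x}" using h g(1) by (intro commutes_with_x) simp_all
      moreover have "g = h \<otimes> ?z" using h g(1) by (simp flip: m_assoc)
      ultimately show ?thesis using h by auto
    qed
    then have "card {g \<in> carrier G. ?c g = k} \<le> card {h, h \<otimes> x}"
      by (intro card_mono) auto
    also have "\<dots> \<le> 2" by (simp add: card_insert_if)
    finally show ?thesis .
  qed
  have "carrier G = (\<Union>k\<in>reflections. {g \<in> carrier G. ?c g = k})"
    by (auto simp: reflections_def)
  then have "order G = card (\<Union>k\<in>reflections. {g \<in> carrier G. ?c g = k})"
    by (simp add: order_def)
  also have "\<dots> \<le> (\<Sum>k\<in>reflections. card {g \<in> carrier G. ?c g = k})"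
    by (rule card_UN_le) (simp add: reflections_def finite_carrier)
  also have "\<dots> \<le> (\<Sum>k\<in>reflections. 2)"
    by (rule sum_mono) (rule fibre)
  finally show ?thesis by simp
qed

text \<open>If \<open>x k\<close> were a reflection then \<open>x\<close> and \<open>k\<close> would commute, forcing \<open>k = x\<close> and \<open>x k = 1\<close>.
  Hence \<open>x\<close> maps the reflections into their complement, and by size onto it.\<close>

lemma x_times_reflections: "(\<lambda>k. x \<otimes> k) ` reflections = rotations"
  and order_eq_twice_rotations: "order G = 2 * card rotations"
proof -
  have fin: "finite reflections" "finite rotations"
    unfolding reflections_def rotations_def using finite_carrier by simp_all
  have into: "x \<otimes> k \<in> rotations" if k: "k \<in> reflections" for k
  proof (rule ccontr)
    interpret K: self_centralizing_involution G k
      by (rule reflection_self_centralizing[OF k])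
    assume "x \<otimes> k \<notin> rotations"
    then have xk: "x \<otimes> k \<in> reflections" by (simp add: rotations_def)
    then interpret XK: self_centralizing_involution G "x \<otimes> k"
      by (rule reflection_self_centralizing)
    have "inv (x \<otimes> k) = k \<otimes> x"
      by (subst inv_mult_group) simp_all
    then have "x \<otimes> k = k \<otimes> x" by simp
    then have "k \<in> {\<one>, x}" by (intro commutes_with_x) simp_all
    then show False using K.x_ne_one XK.x_ne_one by auto
  qed
  have card_im: "card ((\<lambda>k. x \<otimes> k) ` reflections) = card reflections"
    by (rule card_image) (auto simp: inj_on_def reflections_closed)
  have sub: "(\<lambda>k. x \<otimes> k) ` reflections \<subseteq> rotations" using into by blast
  have le: "card reflections \<le> card rotations"
    using card_mono[OF fin(2) sub] card_im by simp
  have "order G = card reflections + card rotations"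
    unfolding order_def rotations_def
    by (metis (no_types, lifting) Diff_partition card_Un_disjoint Diff_disjoint fin reflections_closed
        rotations_def subsetI)
  then have "card rotations = card reflections \<and> order G = 2 * card rotations"
    using le order_le_twice_reflections by linarith
  then show "(\<lambda>k. x \<otimes> k) ` reflections = rotations" "order G = 2 * card rotations"
    using card_subset_eq[OF fin(2) sub] card_im by simp_all
qed

lemma reflection_times_reflections:
  assumes k: "k \<in> reflections"
  shows "(\<lambda>l. k \<otimes> l) ` reflections = rotations"
proof -
  interpret K: self_centralizing_involution G k
    by (rule reflection_self_centralizing[OF k])
  show ?thesis
    using K.x_times_reflections unfolding K.rotations_def rotations_def reflections_conjugate[OF k] .
qed

lemma rotations_closed: "v \<in> rotations \<Longrightarrow> v \<in> carrier G"
  by (simp add: rotations_def)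

text \<open>A rotation is a product \<open>x k\<close> of two involutions, with inverse \<open>k x\<close>, so both sides
  equal \<open>k\<close>.\<close>

lemma rotation_conjugate:
  assumes "v \<in> rotations"
  shows "x \<otimes> v = inv v \<otimes> x"
proof -
  obtain k where k: "k \<in> reflections" "v = x \<otimes> k" using assms x_times_reflections by blast
  interpret K: self_centralizing_involution G k
    by (rule reflection_self_centralizing[OF k(1)])
  show ?thesis
    using k by (simp add: inv_mult_group m_assoc) (simp flip: m_assoc)
qed

text \<open>The product of two rotations is \<open>(x k) (k l) = x l\<close>, because the second factor can be
  written with any reflection \<open>k\<close> in front.\<close>

lemma subgroup_rotations: "subgroup rotations G"
proof (rule subgroupI)
  show "rotations \<subseteq> carrier G" by (auto simp: rotations_def)
  show "rotations \<noteq> {}" using x_times_reflections x_reflection by blast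
  show "inv v \<in> rotations" if v: "v \<in> rotations" for v
  proof -
    obtain k where k: "k \<in> reflections" "v = x \<otimes> k" using v x_times_reflections by blast
    interpret K: self_centralizing_involution G k
      by (rule reflection_self_centralizing[OF k(1)])
    have "inv v = k \<otimes> x" using k by (simp add: inv_mult_group)
    then show ?thesis using reflection_times_reflections[OF k(1)] x_reflection by blast
  qed
  show "u \<otimes> v \<in> rotations" if u: "u \<in> rotations" and v: "v \<in> rotations" for u v
  proof -
    obtain k where k: "k \<in> reflections" "u = x \<otimes> k" using u x_times_reflections by blast
    interpret K: self_centralizing_involution G k
      by (rule reflection_self_centralizing[OF k(1)])
    obtain l where l: "l \<in> reflections" "v = k \<otimes> l"
      using v reflection_times_reflections[OF k(1)] by blast
    have "k \<otimes> (k \<otimes> l) = l" using reflections_closed[OF l(1)] by (simp flip: m_assoc)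
    then have "u \<otimes> v = x \<otimes> l" using k l reflections_closed[OF l(1)] by (simp add: m_assoc)
    then show ?thesis using l(1) x_times_reflections by blast
  qed
qed

text \<open>If the order were even, Sylow's theorem would give an involution \<open>t\<close> among the rotations.
  Conjugation by \<open>x\<close> inverts \<open>t\<close>, hence fixes it, so \<open>t\<close> would lie in the centralizer of \<open>x\<close>.\<close>

lemma odd_card_rotations: "odd (card rotations)"
proof
  assume "even (card rotations)"
  then obtain m where m: "card rotations = 2 ^ 1 * m" by auto
  interpret N: subgroup rotations G by (rule subgroup_rotations)
  let ?N = "G\<lparr>carrier := rotations\<rparr>"
  have grp: "group ?N" by (rule N.subgroup_is_group[OF is_group])
  have "\<exists>P. subgroup P ?N \<and> card P = 2 ^ 1"
    by (rule sylow_thm[OF _ grp, of 2 1 m])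
       (use m finite_carrier in \<open>auto simp: order_def rotations_def\<close>)
  then obtain P where P: "subgroup P ?N" "card P = 2" by auto
  interpret P: subgroup P G
    using subgroup_incl[of] P(1) incl_subgroup[OF subgroup_rotations] by blast
  have "P - {\<one>} \<noteq> {}"
    using P(2) by (metis P.one_closed card_1_singleton_iff insert_Diff numeral_eq_one_iff
        semiring_norm(85) One_nat_def)
  then obtain t where t: "t \<in> P" "t \<noteq> \<one>" by blast
  have tN: "t \<in> rotations" using t P(1) subgroup.subset by fastforce
  have "P = {\<one>, t}"
    using P(2) t P.one_closed by (intro card_seteq[symmetric]) (auto intro: card_ge_0_finite)
  moreover have "t \<otimes> t \<in> P" using t by simp
  ultimately have "t \<otimes> t = \<one>" using t rotations_closed[OF tN] by auto
  then have "inv t = t" using rotations_closed[OF tN] by (intro inv_equality) simp_all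
  then have "t \<in> {\<one>, x}"
    using rotation_conjugate[OF tN] rotations_closed[OF tN] by (intro commutes_with_x) simp_all
  then show False
    using t tN x_reflection by (auto simp: rotations_def)
qed

text \<open>Any rotation \<open>r \<noteq> \<one>\<close> has order \<open>n = card rotations\<close>, because \<open>n\<close> is prime. The isomorphism
  from \<open>dihedral n\<close> sends \<open>(a, False)\<close> to \<open>r^a\<close> and \<open>(a, True)\<close> to \<open>r^a x\<close>. It is injective because
  \<open>x\<close> is not a rotation, and surjective because both groups have \<open>2 n\<close> elements.\<close>

lemma prime_imp_dihedral:
  assumes p: "Factorial_Ring.prime (card rotations)"
  shows "G \<cong> dihedral (card rotations)"
proof -
  define n where "n = card rotations"
  interpret N: subgroup rotations G by (rule subgroup_rotations)
  let ?N = "G\<lparr>carrier := rotations\<rparr>"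
  have grp: "group ?N" by (rule N.subgroup_is_group[OF is_group])
  have n: "Factorial_Ring.prime n" "n > 1" using p prime_gt_1_nat by (auto simp: n_def)
  have "rotations \<noteq> {\<one>}"
    using n(2) by (auto simp: n_def)
  then obtain r where r: "r \<in> rotations" "r \<noteq> \<one>" using N.one_closed by blast
  have rc [simp]: "r \<in> carrier G" using r by simp
  have "r [^] n = \<one>"
    using group.pow_order_eq_1[OF grp, of r] r(1) by (simp add: n_def order_def flip: nat_pow_consistent)
  then have "ord r dvd n" using pow_eq_id[OF rc] by simp
  moreover have "ord r \<noteq> 1" using r(2) ord_eq_1[OF rc] by simp
  ultimately have ord: "ord r = n" using n(1) prime_nat_iff by blast
  have pow_eq: "r [^] a = r [^] b \<longleftrightarrow> int n dvd b - a" for a b :: int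
    using int_pow_eq[OF rc] ord by simp
  have pow_mod: "r [^] (a mod int n) = r [^] a" for a :: int
    unfolding pow_eq by (simp add: dvd_minus_mod)
  have powN: "r [^] a \<in> rotations" for a :: int
    using subgroup_int_pow_closed[OF subgroup_rotations r(1)] .
  have swap: "x \<otimes> r [^] a = r [^] (- a) \<otimes> x" for a :: int
    using rotation_conjugate[OF powN] by (simp add: int_pow_neg)
  define f where "f = (\<lambda>(a :: int, s). r [^] a \<otimes> (if s then x else \<one>))"
  have grpD: "group (dihedral n)" using n by (intro group_dihedral) simp
  have f_closed: "f u \<in> carrier G" for u by (cases u) (simp add: f_def)
  have hom: "f \<in> hom (dihedral n) G"
  proof (rule homI)
    fix u v :: "int \<times> bool"
    obtain a s b t where uv: "u = (a, s)" "v = (b, t)" by (cases u, cases v)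
    have mid: "r [^] a \<otimes> x \<otimes> (r [^] b \<otimes> y) = r [^] (a - b) \<otimes> (x \<otimes> y)"
      if "y \<in> carrier G" for y
    proof -
      have "r [^] a \<otimes> x \<otimes> (r [^] b \<otimes> y) = r [^] a \<otimes> (x \<otimes> r [^] b) \<otimes> y"
        using that by (simp add: m_assoc)
      also have "\<dots> = r [^] a \<otimes> r [^] (- b) \<otimes> (x \<otimes> y)"
        unfolding swap using that by (simp add: m_assoc)
      also have "r [^] a \<otimes> r [^] (- b) = r [^] (a - b)"
        using int_pow_mult[OF rc, of a "- b"] by simp
      finally show ?thesis .
    qed
    show "f (u \<otimes>\<^bsub>dihedral n\<^esub> v) = f u \<otimes> f v"
      using mid[of \<one>] mid[of x]
      by (cases s; cases t)
         (simp_all add: uv f_def dihedral_def pow_mod int_pow_mult m_assoc)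
  qed (rule f_closed)
  \<comment> \<open>\<open>r\<close> generates rotations only, so the reflection \<open>x\<close> is not a quotient of its powers.\<close>
  have x_rot: "r [^] a \<noteq> r [^] b \<otimes> x" for a b :: int
  proof
    assume "r [^] a = r [^] b \<otimes> x"
    then have "x = inv (r [^] b) \<otimes> r [^] a" by (simp add: inv_solve_left)
    moreover have "inv (r [^] b) \<otimes> r [^] a \<in> rotations"
      using powN by (intro N.m_closed N.m_inv_closed)
    ultimately have "x \<in> rotations" by metis
    then show False using x_reflection by (simp add: rotations_def)
  qed
  have inj: "inj_on f (carrier (dihedral n))"
  proof (rule inj_onI)
    fix u v :: "int \<times> bool"
    assume u: "u \<in> carrier (dihedral n)" and v: "v \<in> carrier (dihedral n)" and eq: "f u = f v"
    obtain a s b t where uv: "u = (a, s)" "v = (b, t)" by (cases u, cases v)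
    have "s = t" using eq x_rot x_rot[symmetric] by (auto simp: uv f_def split: if_splits)
    then have "r [^] a = r [^] b" using eq by (auto simp: uv f_def split: if_splits)
    then have "int n dvd b - a" by (simp add: pow_eq)
    then have "b mod int n = a mod int n" by (simp add: mod_eq_dvd_iff)
    then show "u = v" using u v \<open>s = t\<close> by (simp add: uv dihedral_def)
  qed
  have "card (f ` carrier (dihedral n)) = card (carrier G)"
    using card_image[OF inj] order_dihedral[of n] order_eq_twice_rotations
    by (simp add: order_def n_def)
  then have "f ` carrier (dihedral n) = carrier G"
    using f_closed by (intro card_subset_eq finite_carrier) auto
  then have "f \<in> iso (dihedral n) G"
    using hom inj by (simp add: iso_def bij_betw_def)
  then show ?thesis
    using group.iso_sym[OF grpD] by (auto simp: is_iso_def n_def)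
qed

end

section \<open>Involutions of dihedral groups\<close>

text \<open>For odd \<open>n\<close>, doubling is injective modulo \<open>n\<close>. So no rotation is an involution, and a rotation
  commuting with a reflection, or the quotient of two commuting reflections, is trivial.\<close>

lemma dihedral_involution_commuting:
  assumes n: "odd n"
    and u: "u \<in> carrier (dihedral n)" "u \<otimes>\<^bsub>dihedral n\<^esub> u = \<one>\<^bsub>dihedral n\<^esub>" "u \<noteq> \<one>\<^bsub>dihedral n\<^esub>"
    and v: "v \<in> carrier (dihedral n)" "u \<otimes>\<^bsub>dihedral n\<^esub> v = v \<otimes>\<^bsub>dihedral n\<^esub> u"
  shows "v = \<one>\<^bsub>dihedral n\<^esub> \<or> v = u"
proof -
  have double: "c mod int n = d mod int n"
    if "(2 * c) mod int n = (2 * d) mod int n" for c d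
  proof -
    have "int n dvd 2 * (c - d)" using that by (simp add: mod_eq_dvd_iff algebra_simps)
    moreover have "coprime (int n) 2" using n by simp
    ultimately have "int n dvd c - d" by (simp only: coprime_dvd_mult_right_iff)
    then show ?thesis by (simp add: mod_eq_dvd_iff)
  qed
  obtain a s b t where uv: "u = (a, s)" "v = (b, t)" by (cases u, cases v)
  have range: "a mod int n = a" "b mod int n = b"
    using u(1) v(1) by (auto simp: uv dihedral_def)
  have "s"
  proof (rule ccontr)
    assume "\<not> s"
    then have "a mod int n = 0 mod int n"
      using u(2) by - (rule double, simp add: uv dihedral_def)
    then show False using u(3) \<open>\<not> s\<close> range by (simp add: uv dihedral_def)
  qed
  show ?thesis
  proof (cases t)
    case True
    then have "(a - b) mod int n = (b - a) mod int n"
      using v(2) \<open>s\<close> by (simp add: uv dihedral_def)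
    then have "a mod int n = b mod int n"
      by - (rule double, simp add: mod_eq_dvd_iff algebra_simps)
    then show ?thesis using range \<open>s\<close> True by (simp add: uv)
  next
    case False
    then have "(a - b) mod int n = (b + a) mod int n"
      using v(2) \<open>s\<close> by (simp add: uv dihedral_def)
    then have "0 mod int n = b mod int n"
      by - (rule double, simp add: mod_eq_dvd_iff algebra_simps)
    then show ?thesis using range False by (simp add: uv dihedral_def)
  qed
qed

lemma (in group) iso_dihedral_involution_self_centralizing:
  assumes iso: "G \<cong> dihedral n" and n: "odd n"
    and x: "x \<in> carrier G" "x \<otimes> x = \<one>" "x \<noteq> \<one>"
  shows "centralizer G x = {\<one>, x}"
proof -
  interpret D: group "dihedral n" using n by (intro group_dihedral) (auto elim: oddE)
  obtain f where f: "f \<in> hom G (dihedral n)" "bij_betw f (carrier G) (carrier (dihedral n))"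
    using iso by (auto simp: is_iso_def iso_def)
  have inj: "f u = f v \<longleftrightarrow> u = v" if "u \<in> carrier G" "v \<in> carrier G" for u v
    using f(2) that by (auto simp: bij_betw_def inj_on_def)
  have one: "f \<one> = \<one>\<^bsub>dihedral n\<^esub>"
    using hom_one[OF f(1) is_group D.is_group] .
  have "y \<in> {\<one>, x}" if y: "y \<in> centralizer G x" for y
  proof -
    have yc: "y \<in> carrier G" "x \<otimes> y = y \<otimes> x" using y by (auto simp: centralizer_def)
    have "f y = \<one>\<^bsub>dihedral n\<^esub> \<or> f y = f x"
    proof (rule dihedral_involution_commuting[OF n])
      show "f x \<otimes>\<^bsub>dihedral n\<^esub> f x = \<one>\<^bsub>dihedral n\<^esub>"
        using hom_mult[OF f(1) x(1) x(1)] x(2) one by simp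
      show "f x \<noteq> \<one>\<^bsub>dihedral n\<^esub>" using inj[OF x(1) one_closed] x(3) one by simp
      show "f x \<otimes>\<^bsub>dihedral n\<^esub> f y = f y \<otimes>\<^bsub>dihedral n\<^esub> f x"
        using hom_mult[OF f(1)] x(1) yc by metis
    qed (use f(1) x(1) yc in \<open>auto simp: hom_def\<close>)
    then show ?thesis using inj x(1) yc one by (metis insertCI one_closed)
  qed
  then show ?thesis using x by (auto simp: centralizer_def)
qed

section \<open>Trees of order at most twelve\<close>

theorem theorem2p4:
  fixes G :: "('a, 'b) monoid_scheme" and H :: "'a set" and g :: 'a
  assumes "group G"
    and "finite (carrier G)"
    and "\<not> comm_group G"
    and "order G \<le> 12"
    and "subgroup H G"
    and "H \<noteq> relative_centre G H"
    and "g = \<one>\<^bsub>G\<^esub>"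
  shows "undirected_tree (noncomm_graph G H g) \<longleftrightarrow>
    (G \<cong> dihedral 3 \<or> G \<cong> dihedral 5) \<and> card H = 2"
proof -
  interpret group G by fact
  interpret H: subgroup H G by fact
  have one_central: "centralizer G \<one>\<^bsub>G\<^esub> = carrier G" by (auto simp: centralizer_def)
  have nontrivial: "carrier G \<noteq> {\<one>\<^bsub>G\<^esub>}" and not_order_two: "\<And>x. carrier G \<noteq> {\<one>\<^bsub>G\<^esub>, x}"
  proof -
    have "comm_group G" if "\<And>u v. u \<in> carrier G \<Longrightarrow> v \<in> carrier G \<Longrightarrow> u \<otimes>\<^bsub>G\<^esub> v = v \<otimes>\<^bsub>G\<^esub> u"
      using that group_comm_groupI by blast
    then show "carrier G \<noteq> {\<one>\<^bsub>G\<^esub>}" "\<And>x. carrier G \<noteq> {\<one>\<^bsub>G\<^esub>, x}"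
      using assms(3) by (metis insert_iff l_one one_closed r_one singletonD)+
  qed
  have "(\<exists>x. H = {\<one>\<^bsub>G\<^esub>, x} \<and> centralizer G x = {\<one>\<^bsub>G\<^esub>, x}) \<longleftrightarrow>
    (G \<cong> dihedral 3 \<or> G \<cong> dihedral 5) \<and> card H = 2" (is "?L \<longleftrightarrow> ?R")
  proof
    assume ?L
    then obtain x where x: "H = {\<one>\<^bsub>G\<^esub>, x}" "centralizer G x = {\<one>\<^bsub>G\<^esub>, x}" by blast
    have ne: "x \<noteq> \<one>\<^bsub>G\<^esub>" using x(2) one_central nontrivial by auto
    interpret self_centralizing_involution G x
      by unfold_locales (use assms(2) x ne H.subset in auto)
    have "card rotations \<noteq> 1"
    proof
      assume "card rotations = 1"
      then have "card (carrier G) = card {\<one>\<^bsub>G\<^esub>, x}"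
        using order_eq_twice_rotations ne by (simp add: order_def)
      then have "{\<one>\<^bsub>G\<^esub>, x} = carrier G"
        using assms(2) by (intro card_subset_eq) auto
      then show False using not_order_two by metis
    qed
    moreover have "card rotations \<le> 6" using order_eq_twice_rotations assms(4) by simp
    moreover obtain m where "card rotations = 2 * m + 1"
      using odd_card_rotations by (elim oddE)
    ultimately have "card rotations = 3 \<or> card rotations = 5" by presburger
    moreover have "Factorial_Ring.prime (3 :: nat)" "Factorial_Ring.prime (5 :: nat)" by simp_all
    ultimately have "G \<cong> dihedral 3 \<or> G \<cong> dihedral 5" using prime_imp_dihedral by metis
    then show ?R using x(1) ne by simp
  next
    assume R: ?R
    then have "card (H - {\<one>\<^bsub>G\<^esub>}) = 1" by simp
    then obtain x where "H - {\<one>\<^bsub>G\<^esub>} = {x}" by (rule card_1_singletonE)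
    then have x: "H = {\<one>\<^bsub>G\<^esub>, x}" "x \<noteq> \<one>\<^bsub>G\<^esub>" using H.one_closed by blast+
    have xc: "x \<in> carrier G" using x H.subset by simp
    have "x \<otimes>\<^bsub>G\<^esub> x \<in> H" using x by (intro H.m_closed) simp_all
    then have "x \<otimes>\<^bsub>G\<^esub> x = \<one>\<^bsub>G\<^esub>" using x xc by auto
    then have "centralizer G x = {\<one>\<^bsub>G\<^esub>, x}"
      using R iso_dihedral_involution_self_centralizing[OF _ _ xc _ x(2)] by auto
    then show ?L using x(1) by blast
  qed
  then show ?thesis
    using undirected_tree_noncomm_graph_iff[OF assms(2,5,6)] assms(7) by simp
qed

end
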